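(* For every positive integer $r$, every ordered graph with delayed rank at least $3r-2$ contains $K_r$ as an interval minor.
   Context: An ordered graph is a finite simple graph with a linear order on its vertices. It contains $K_r$ as an interval minor if its vertex set can be partitioned into $r$ nonempty intervals (sets of consecutive vertices) with an edge between any two of them. It is monotone bipartite if its vertex set splits as $X\cup Y$ with every vertex of $X$ before every vertex of $Y$ and every edge joining $X$ to $Y$ (edgeless graphs included). Canonical delayed decomposition of $(G,<)$, $V=V(G)$: build a rooted tree $T$ top-down, assigning to each node $x$ an interval $L(x)$ of $(V,<)$; the root has $L=V$. For a node $x$: (i) if $|L(x)|=1$, $x$ gets one child, a leaf identified with the vertex of $L(x)$; (ii) if $|L(x)|\ge2$ and $L(x)$ is a module (each vertex outside $L(x)$ is adjacent to all or none of $L(x)$), $x$ gets two children $y_1,y_2$ with $L(y_1)=\{u\}$, $u$ the minimum of $L(x)$, and $L(y_2)=L(x)\setminus\{u\}$; (iii) otherwise, with $u_1\sim u_2$ iff every $w$ in the interval between $u_1,u_2$ has the same neighbourhood in $V\setminus L(x)$ as $u_1$ and $u_2$, the classes of $\sim$ are intervals $I_1<\dots<I_k$ and $x$ gets children $y_1,\dots,y_k$ with $L(y_i)=I_i$. Nodes not in ancestor–descendant relation are ordered by $x<y$ iff $L(x)<L(y)$. For each node $x$, the quotient graph $G_x$ is the ordered graph on the grandchildren of $x$ in which two non-sibling grandchildren $y,y'$ are adjacent iff $G$ has an edge between $L(y)$ and $L(y')$. Labels: nodes without grandparent get label $\emptyset$; otherwise $x$ gets $R$ if some cousin (non-sibling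 node with the same grandparent $p^2(x)$) $x'>x$ has $xx'\in E(G_{p^2(x)})$, else $L$ if some cousin $x'<x$ has $xx'\in E(G_{p^2(x)})$, else $O$. If a node labelled $O$ is not the first child of its parent and its parent has at least $3$ children, its label becomes $O_L$ (resp. $O_R$) if its immediately preceding sibling is labelled $L$ (resp. $R$). The type of a node is the label of its parent. Refined quotient graphs of a non-monotone-bipartite $(G,<)$: for each quotient graph $G_x$ of the canonical decomposition: if $G_x$ is monotone bipartite, it is a refined quotient graph. Otherwise, if the first child of $x$ is labelled $O$, delete its children from $G_x$; remaining vertices have type $R,L,O_R$ or $O_L$; put $R'=\{R,O_R\}$, $L'=\{L,O_L\}$ and classify edges by the classes of the types of their left and right endpoints ($R'R',R'L',L'R',L'L'$). The four refined quotient graphs are: the graph on the remaining vertices with the $R'R'$ edges, minus vertices before the first and after the last vertex of type $R$; with the $R'L'$ edges, minus vertices before the first and after the last vertex of type $L$; with the $L'R'$ edges, minus vertices before the first and after the last vertex of type $R$; with the $L'L'$ edges, minus vertices before the first and after the last vertex of type $L$. Delayed rank: $0$ if $(G,<)$ is monotone bipartite; otherwise $1$ plus the maximum delayed rank of its refined quotient graphs. *)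

theory Defs
  imports "Graph_Theory.Pair_Digraph" "HOL-Library.Disjoint_Sets"
begin

text \<open>
  An ordered graph is a graph \<open>G\<close> with \<open>pair_graph G\<close> (finite, loop-free, with a symmetric set of
  pairs as edge set) whose vertices are taken from a linearly ordered type.
\<close>

definition interval_of :: "'a::linorder set \<Rightarrow> 'a set \<Rightarrow> bool" where
  "interval_of V I \<longleftrightarrow> I \<subseteq> V \<and> (\<forall>a\<in>I. \<forall>b\<in>I. \<forall>c\<in>V. a \<le> c \<and> c \<le> b \<longrightarrow> c \<in> I)"

definition has_complete_interval_minor :: "'a::linorder pair_pre_digraph \<Rightarrow> nat \<Rightarrow> bool" where
  "has_complete_interval_minor G r \<longleftrightarrow>
     (\<exists>P. partition_on (pverts G) P \<and> card P = r \<and> (\<forall>I\<in>P. interval_of (pverts G) I) \<and>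
          (\<forall>I\<in>P. \<forall>J\<in>P. I \<noteq> J \<longrightarrow> (\<exists>u\<in>I. \<exists>v\<in>J. (u, v) \<in> parcs G)))"

definition monotone_bipartite :: "'a::linorder pair_pre_digraph \<Rightarrow> bool" where
  "monotone_bipartite G \<longleftrightarrow>
     (\<exists>X Y. pverts G = X \<union> Y \<and> (\<forall>u\<in>X. \<forall>v\<in>Y. u < v) \<and>
            (\<forall>(u, v)\<in>parcs G. u \<in> X \<and> v \<in> Y \<or> u \<in> Y \<and> v \<in> X))"


subsection \<open>The canonical delayed decomposition\<close>

definition is_module :: "'a pair_pre_digraph \<Rightarrow> 'a set \<Rightarrow> bool" where
  "is_module G A \<longleftrightarrow>
     (\<forall>v\<in>pverts G - A. (\<forall>a\<in>A. (v, a) \<in> parcs G) \<or> (\<forall>a\<in>A. (v, a) \<notin> parcs G))"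

definition outside_nbhd :: "'a pair_pre_digraph \<Rightarrow> 'a set \<Rightarrow> 'a \<Rightarrow> 'a set" where
  "outside_nbhd G A u = {w \<in> pverts G - A. (u, w) \<in> parcs G}"

definition twin_rel :: "'a::linorder pair_pre_digraph \<Rightarrow> 'a set \<Rightarrow> 'a rel" where
  "twin_rel G A = {(u1, u2). u1 \<in> A \<and> u2 \<in> A \<and>
     (\<forall>w\<in>pverts G. min u1 u2 \<le> w \<and> w \<le> max u1 u2 \<longrightarrow>
        outside_nbhd G A w = outside_nbhd G A u1 \<and> outside_nbhd G A w = outside_nbhd G A u2)}"

text \<open>
  A node of the tree is encoded by the list of the sets \<open>L\<close> along the path from the node up to the
  root, the node's own set first. So \<open>hd x\<close> is \<open>L(x)\<close>, \<open>tl x\<close> is the parent of \<open>x\<close>, and \<open>x\<close> is the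
  root iff its length is \<open>1\<close>. A leaf repeats the singleton of its parent, which happens for no other
  node.
\<close>

type_synonym 'a node = "'a set list"

definition is_leaf :: "'a node \<Rightarrow> bool" where
  "is_leaf x \<longleftrightarrow> tl x \<noteq> [] \<and> hd x = hd (tl x)"

definition child_sets :: "'a::linorder pair_pre_digraph \<Rightarrow> 'a node \<Rightarrow> 'a set set" where
  "child_sets G x =
     (if 2 \<le> card (hd x) then
        if is_module G (hd x) then {{Min (hd x)}, hd x - {Min (hd x)}}
        else hd x // twin_rel G (hd x)
      else if card (hd x) = 1 \<and> \<not> is_leaf x then {hd x}
      else {})"

definition children :: "'a::linorder pair_pre_digraph \<Rightarrow> 'a node \<Rightarrow> 'a node set" where
  "children G x = (\<lambda>I. I # x) ` child_sets G x"

inductive_set nodes :: "'a::linorder pair_pre_digraph \<Rightarrow> 'a node set"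
  for G :: "'a::linorder pair_pre_digraph" where
  root: "[pverts G] \<in> nodes G"
| child: "x \<in> nodes G \<Longrightarrow> y \<in> children G x \<Longrightarrow> y \<in> nodes G"

definition node_less :: "'a::linorder node \<Rightarrow> 'a node \<Rightarrow> bool" where
  "node_less x y \<longleftrightarrow> (\<forall>u\<in>hd x. \<forall>v\<in>hd y. u < v)"

definition grandchildren :: "'a::linorder pair_pre_digraph \<Rightarrow> 'a node \<Rightarrow> 'a node set" where
  "grandchildren G x = (\<Union>y\<in>children G x. children G y)"

text \<open>Adjacency in the quotient graph of the common grandparent of \<open>y\<close> and \<open>y'\<close>.\<close>

definition quotient_adj :: "'a pair_pre_digraph \<Rightarrow> 'a node \<Rightarrow> 'a node \<Rightarrow> bool" where
  "quotient_adj G y y' \<longleftrightarrow> tl y \<noteq> tl y' \<and> (\<exists>u\<in>hd y. \<exists>v\<in>hd y'. (u, v) \<in> parcs G)"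

text \<open>
  To stay within one vertex type, a graph on pairwise incomparable nodes is turned into an ordered
  graph on vertices of \<open>G\<close> by representing each node \<open>y\<close> by the least vertex of \<open>L(y)\<close>. The sets
  \<open>L(y)\<close> of the grandchildren \<open>y\<close> of a node are nonempty disjoint intervals, so this is injective on
  them and turns \<open>node_less\<close> into the order of the vertices.
\<close>

definition node_graph ::
  "'a::linorder node set \<Rightarrow> ('a node \<Rightarrow> 'a node \<Rightarrow> bool) \<Rightarrow> 'a pair_pre_digraph" where
  "node_graph N adj =
     \<lparr> pverts = (\<lambda>y. Min (hd y)) ` N,
       parcs = {(Min (hd y), Min (hd y')) | y y'. y \<in> N \<and> y' \<in> N \<and> adj y y'} \<rparr>"

definition quotient_graph :: "'a::linorder pair_pre_digraph \<Rightarrow> 'a node \<Rightarrow> 'a pair_pre_digraph" where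
  "quotient_graph G x = node_graph (grandchildren G x) (quotient_adj G)"


subsection \<open>Labels and types\<close>

datatype label = Lab_Empty | Lab_R | Lab_L | Lab_O | Lab_OL | Lab_OR

definition base_label :: "'a::linorder pair_pre_digraph \<Rightarrow> 'a node \<Rightarrow> label" where
  "base_label G x =
     (if length x < 3 then Lab_Empty
      else if \<exists>x'\<in>grandchildren G (tl (tl x)). node_less x x' \<and> quotient_adj G x x' then Lab_R
      else if \<exists>x'\<in>grandchildren G (tl (tl x)). node_less x' x \<and> quotient_adj G x x' then Lab_L
      else Lab_O)"

definition immediately_precedes ::
  "'a::linorder pair_pre_digraph \<Rightarrow> 'a node \<Rightarrow> 'a node \<Rightarrow> bool" where
  "immediately_precedes G z x \<longleftrightarrow>
     z \<in> children G (tl x) \<and> node_less z x \<and>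
     \<not> (\<exists>w\<in>children G (tl x). node_less z w \<and> node_less w x)"

definition label :: "'a::linorder pair_pre_digraph \<Rightarrow> 'a node \<Rightarrow> label" where
  "label G x =
     (if base_label G x = Lab_O \<and> 3 \<le> card (children G (tl x)) then
        if \<exists>z. immediately_precedes G z x \<and> base_label G z = Lab_L then Lab_OL
        else if \<exists>z. immediately_precedes G z x \<and> base_label G z = Lab_R then Lab_OR
        else Lab_O
      else base_label G x)"

definition node_type :: "'a::linorder pair_pre_digraph \<Rightarrow> 'a node \<Rightarrow> label" where
  "node_type G x = label G (tl x)"


subsection \<open>Refined quotient graphs\<close>

definition is_first_child :: "'a::linorder pair_pre_digraph \<Rightarrow> 'a node \<Rightarrow> bool" where
  "is_first_child G y \<longleftrightarrow> (\<forall>z\<in>children G (tl y). z \<noteq> y \<longrightarrow> node_less y z)"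

definition remaining_nodes :: "'a::linorder pair_pre_digraph \<Rightarrow> 'a node \<Rightarrow> 'a node set" where
  "remaining_nodes G x =
     {y \<in> grandchildren G x. \<not> (is_first_child G (tl y) \<and> label G (tl y) = Lab_O)}"

text \<open>
  The remaining vertices between the first and the last one of type \<open>t\<close> (none if \<open>t\<close> does not occur).
\<close>

definition trimmed_nodes ::
  "'a::linorder pair_pre_digraph \<Rightarrow> label \<Rightarrow> 'a node \<Rightarrow> 'a node set" where
  "trimmed_nodes G t x =
     {y \<in> remaining_nodes G x.
        (\<exists>a\<in>remaining_nodes G x. node_type G a = t \<and> (a = y \<or> node_less a y)) \<and>
        (\<exists>b\<in>remaining_nodes G x. node_type G b = t \<and> (b = y \<or> node_less y b))}"

definition class_adj ::
  "'a::linorder pair_pre_digraph \<Rightarrow> label set \<Rightarrow> label set \<Rightarrow> 'a node \<Rightarrow> 'a node \<Rightarrow> bool" where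
  "class_adj G C D y y' \<longleftrightarrow> quotient_adj G y y' \<and>
     (node_less y y' \<and> node_type G y \<in> C \<and> node_type G y' \<in> D \<or>
      node_less y' y \<and> node_type G y' \<in> C \<and> node_type G y \<in> D)"

definition class_graph ::
  "'a::linorder pair_pre_digraph \<Rightarrow> label set \<Rightarrow> label set \<Rightarrow> label \<Rightarrow> 'a node \<Rightarrow>
   'a pair_pre_digraph" where
  "class_graph G C D t x = node_graph (trimmed_nodes G t x) (class_adj G C D)"

definition refined_quotients_at ::
  "'a::linorder pair_pre_digraph \<Rightarrow> 'a node \<Rightarrow> 'a pair_pre_digraph set" where
  "refined_quotients_at G x =
     (if monotone_bipartite (quotient_graph G x) then {quotient_graph G x}
      else {class_graph G {Lab_R, Lab_OR} {Lab_R, Lab_OR} Lab_R x,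
            class_graph G {Lab_R, Lab_OR} {Lab_L, Lab_OL} Lab_L x,
            class_graph G {Lab_L, Lab_OL} {Lab_R, Lab_OR} Lab_R x,
            class_graph G {Lab_L, Lab_OL} {Lab_L, Lab_OL} Lab_L x})"

definition refined_quotients :: "'a::linorder pair_pre_digraph \<Rightarrow> 'a pair_pre_digraph set" where
  "refined_quotients G = (\<Union>x\<in>nodes G. refined_quotients_at G x)"


subsection \<open>Delayed rank\<close>

lemma child_sets_nonempty_subset:
  assumes "finite (hd x)" "I \<in> child_sets G x"
  shows "I \<noteq> {} \<and> I \<subseteq> hd x"
proof (cases "2 \<le> card (hd x)")
  case True
  then have ne: "hd x \<noteq> {}" by auto
  have m: "Min (hd x) \<in> hd x" using ne assms(1) by simp
  have d: "hd x - {Min (hd x)} \<noteq> {}"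
  proof
    assume "hd x - {Min (hd x)} = {}"
    then have "card (hd x) \<le> card {Min (hd x)}" by (intro card_mono) auto
    then show False using True by simp
  qed
  show ?thesis
  proof (cases "is_module G (hd x)")
    case T2: True
    then show ?thesis using assms True m d by (auto simp: child_sets_def)
  next
    case False
    then obtain a where a: "a \<in> hd x" "I = twin_rel G (hd x) `` {a}"
      using assms True by (auto simp: child_sets_def quotient_def)
    have "(a, a) \<in> twin_rel G (hd x)" using a by (auto simp: twin_rel_def)
    then have "a \<in> I" using a(2) by blast
    moreover have "twin_rel G (hd x) \<subseteq> hd x \<times> hd x" by (auto simp: twin_rel_def)
    ultimately show ?thesis using a(2) by blast
  qed
next
  case False
  then show ?thesis using assms by (auto simp: child_sets_def split: if_splits)
qed

lemma childrenD:
  assumes "finite (hd x)" "y \<in> children G x"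
  shows "tl y = x" "hd y \<noteq> {}" "hd y \<subseteq> hd x" "finite (hd y)"
proof -
  obtain I where I: "I \<in> child_sets G x" "y = I # x" using assms(2) by (auto simp: children_def)
  note J = child_sets_nonempty_subset[OF assms(1) I(1)]
  show "tl y = x" "hd y \<noteq> {}" "hd y \<subseteq> hd x" "finite (hd y)"
    using I J finite_subset[OF _ assms(1)] by auto
qed

lemma grandchildrenD:
  assumes "finite (hd x)" "y \<in> grandchildren G x"
  shows "tl y \<in> children G x" "y \<in> children G (tl y)" "hd y \<noteq> {}" "hd y \<subseteq> hd (tl y)"
    "hd y \<subseteq> hd x" "finite (hd y)" "Min (hd y) \<in> hd y"
proof -
  obtain z where z: "z \<in> children G x" "y \<in> children G z"
    using assms(2) by (auto simp: grandchildren_def)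
  note zD = childrenD[OF assms(1) z(1)]
  note yD = childrenD[OF zD(4) z(2)]
  show "tl y \<in> children G x" "y \<in> children G (tl y)" "hd y \<noteq> {}" "hd y \<subseteq> hd (tl y)"
    "hd y \<subseteq> hd x" "finite (hd y)" "Min (hd y) \<in> hd y"
    using z zD yD by auto
qed

lemma equiv_twin_rel:
  assumes "A \<subseteq> pverts G" shows "equiv A (twin_rel G A)"
proof (rule equivI)
  show "refl_on A (twin_rel G A)" by (auto simp: refl_on_def twin_rel_def)
  show "twin_rel G A \<subseteq> A \<times> A" by (auto simp: twin_rel_def)
  show "sym (twin_rel G A)"
    by (auto simp: sym_def twin_rel_def min.commute max.commute)
  show "trans (twin_rel G A)"
  proof (rule transI)
    fix u v w assume uv: "(u, v) \<in> twin_rel G A" and vw: "(v, w) \<in> twin_rel G A"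
    let ?N = "outside_nbhd G A"
    have A: "u \<in> A" "v \<in> A" "w \<in> A" using uv vw by (auto simp: twin_rel_def)
    have n1: "?N t = ?N u \<and> ?N t = ?N v"
      if "t \<in> pverts G" "min u v \<le> t" "t \<le> max u v" for t
      using uv that by (auto simp: twin_rel_def)
    have n2: "?N t = ?N v \<and> ?N t = ?N w"
      if "t \<in> pverts G" "min v w \<le> t" "t \<le> max v w" for t
      using vw that by (auto simp: twin_rel_def)
    have e1: "?N u = ?N v" using n1[of u] A(1) assms by (simp add: subset_iff)
    have e2: "?N v = ?N w" using n2[of v] A(2) assms by (simp add: subset_iff)
    have "?N t = ?N u \<and> ?N t = ?N w"
      if t: "t \<in> pverts G" "min u w \<le> t" "t \<le> max u w" for t
    proof -
      have "(min u v \<le> t \<and> t \<le> max u v) \<or> (min v w \<le> t \<and> t \<le> max v w)"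
        using t(2,3) by (auto simp: min_def max_def split: if_splits)
      then show ?thesis using n1[OF t(1)] n2[OF t(1)] e1 e2 by auto
    qed
    then show "(u, w) \<in> twin_rel G A" using A by (auto simp: twin_rel_def)
  qed
qed

lemma children_disjoint:
  assumes "hd x \<subseteq> pverts G" "y \<in> children G x" "z \<in> children G x" "y \<noteq> z"
  shows "hd y \<inter> hd z = {}"
proof -
  obtain I J where IJ: "y = I # x" "z = J # x" "I \<in> child_sets G x" "J \<in> child_sets G x" "I \<noteq> J"
    using assms(2-4) by (auto simp: children_def)
  have "I \<inter> J = {}"
  proof (cases "2 \<le> card (hd x) \<and> \<not> is_module G (hd x)")
    case True
    then have "I \<in> hd x // twin_rel G (hd x)" "J \<in> hd x // twin_rel G (hd x)"
      using IJ by (simp_all add: child_sets_def)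
    then show ?thesis using quotient_disj[OF equiv_twin_rel[OF assms(1)]] IJ(5) by blast
  next
    case False
    then show ?thesis using IJ(3-5) by (auto simp: child_sets_def split: if_splits)
  qed
  then show ?thesis using IJ by simp
qed

lemma nodes_props:
  assumes "finite (pverts G)" "x \<in> nodes G"
  shows "hd x \<subseteq> pverts G \<and> (x = [pverts G] \<or> hd x \<noteq> pverts G \<or> card (pverts G) < 2)"
  using assms(2)
proof induction
  case root
  then show ?case by simp
next
  case (child x y)
  then have sub: "hd x \<subseteq> pverts G" by simp
  then have fin: "finite (hd x)" using assms(1) finite_subset by blast
  note yD = childrenD[OF fin child.hyps(2)]
  have "hd y \<noteq> pverts G" if big: "\<not> card (pverts G) < 2"
  proof
    assume eq: "hd y = pverts G"
    then have "hd x = pverts G" using yD sub by auto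
    then have x: "x = [pverts G]" using child.IH big by auto
    have mod: "is_module G (pverts G)" by (auto simp: is_module_def)
    have ne: "pverts G \<noteq> {}" using big by auto
    have "hd y = {Min (pverts G)} \<or> hd y = pverts G - {Min (pverts G)}"
      using child.hyps(2) big mod by (auto simp: x children_def child_sets_def)
    moreover have "Min (pverts G) \<in> pverts G" using ne assms(1) by simp
    moreover have "pverts G \<noteq> {Min (pverts G)}"
    proof
      assume "pverts G = {Min (pverts G)}"
      then have "card (pverts G) = card {Min (pverts G)}" by (rule arg_cong)
      with big show False by simp
    qed
    ultimately show False using eq by blast
  qed
  then show ?case using yD sub by auto
qed

lemma trimmed_nodes_subset: "trimmed_nodes G t x \<subseteq> grandchildren G x"
  by (auto simp: trimmed_nodes_def remaining_nodes_def)

lemma node_graph_verts: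
  assumes "finite (hd x)" "N \<subseteq> grandchildren G x"
  shows "pverts (node_graph N adj) \<subseteq> hd x"
proof
  fix v assume "v \<in> pverts (node_graph N adj)"
  then obtain y where y: "y \<in> N" "v = Min (hd y)" by (auto simp: node_graph_def)
  then show "v \<in> hd x" using grandchildrenD(5,7)[OF assms(1), of y G] assms(2) by blast
qed

lemma pair_graph_node_graph:
  assumes "finite (pverts G)" "hd x \<subseteq> pverts G" "N \<subseteq> grandchildren G x"
    and adj: "\<And>y y'. adj y y' \<Longrightarrow> adj y' y" "\<And>y y'. adj y y' \<Longrightarrow> tl y \<noteq> tl y'"
  shows "pair_graph (node_graph N adj)"
proof -
  let ?H = "node_graph N adj"
  have fin: "finite (hd x)" using assms finite_subset by blast
  have fv: "finite (pverts ?H)" using node_graph_verts[OF fin assms(3)] fin finite_subset by blast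
  have wf: "parcs ?H \<subseteq> pverts ?H \<times> pverts ?H" by (auto simp: node_graph_def)
  have loop: "Min (hd y) \<noteq> Min (hd y')" if "y \<in> N" "y' \<in> N" "adj y y'" for y y'
  proof -
    note yD = grandchildrenD[OF fin, of y G] and yD' = grandchildrenD[OF fin, of y' G]
    have m: "y \<in> grandchildren G x" "y' \<in> grandchildren G x" using that assms(3) by auto
    have "hd (tl y) \<inter> hd (tl y') = {}"
      by (rule children_disjoint[OF assms(2)]) (use yD(1) yD'(1) m adj(2) that in auto)
    then show ?thesis using yD(4,7) yD'(4,7) m by fastforce
  qed
  show ?thesis
  proof
    show "finite (pverts ?H)" by (rule fv)
    show "finite (parcs ?H)" using wf fv finite_subset by blast
    show "fst e \<in> pverts ?H" "snd e \<in> pverts ?H" if "e \<in> parcs ?H" for e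
      using that wf by auto
    show "fst e \<noteq> snd e" if "e \<in> parcs ?H" for e
      using that loop by (auto simp: node_graph_def)
    have "sym (parcs ?H)" using adj(1) unfolding sym_def node_graph_def by auto
    then show "symmetric (with_proj ?H)" by (simp add: symmetric_def)
  qed
qed

lemma quotient_adj_sym:
  assumes "pair_graph G" "quotient_adj G y y'" shows "quotient_adj G y' y"
proof -
  interpret pair_graph G by fact
  have "sym (parcs G)" using pair_sym_arcs by (simp add: symmetric_def)
  then show ?thesis using assms(2) unfolding quotient_adj_def sym_def by metis
qed

lemma refined_quotients_at_cases:
  assumes "H \<in> refined_quotients_at G x"
  obtains "H = quotient_graph G x" "monotone_bipartite (quotient_graph G x)"
  | C D t where "H = class_graph G C D t x" "\<not> monotone_bipartite (quotient_graph G x)"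
  using assms unfolding refined_quotients_at_def by (auto split: if_splits)

lemma refined_quotients_props:
  assumes "pair_graph G" "H \<in> refined_quotients G"
  shows "pair_graph H" "pverts H \<subseteq> pverts G"
proof -
  interpret pair_graph G by fact
  obtain x where x: "x \<in> nodes G" "H \<in> refined_quotients_at G x"
    using assms(2) by (auto simp: refined_quotients_def)
  have sub: "hd x \<subseteq> pverts G" using nodes_props[OF pair_finite_verts x(1)] by simp
  have fin: "finite (hd x)" using sub pair_finite_verts finite_subset by blast
  have qs: "quotient_adj G y y' \<Longrightarrow> tl y \<noteq> tl y'" for y y' by (simp add: quotient_adj_def)
  obtain N adj where H: "H = node_graph N adj" "N \<subseteq> grandchildren G x"
    and adj: "\<And>y y'. adj y y' \<Longrightarrow> adj y' y" "\<And>y y'. adj y y' \<Longrightarrow> tl y \<noteq> tl y'"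
    using x(2)
  proof (cases rule: refined_quotients_at_cases)
    case 1
    show ?thesis
    proof (rule that)
      show "H = node_graph (grandchildren G x) (quotient_adj G)"
        using 1 by (simp add: quotient_graph_def)
    qed (blast intro: quotient_adj_sym[OF assms(1)] dest: qs)+
  next
    case (2 C D t)
    show ?thesis
    proof (rule that)
      show "H = node_graph (trimmed_nodes G t x) (class_adj G C D)"
        using 2 by (simp add: class_graph_def)
      show "trimmed_nodes G t x \<subseteq> grandchildren G x" by (rule trimmed_nodes_subset)
    qed (unfold class_adj_def, (blast intro: quotient_adj_sym[OF assms(1)] dest: qs)+)
  qed
  show "pair_graph H"
    unfolding H(1) by (rule pair_graph_node_graph[OF pair_finite_verts sub H(2) adj])
  show "pverts H \<subseteq> pverts G"
    using node_graph_verts[OF fin H(2)] sub by (auto simp: H(1))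
qed

lemma small_monotone_bipartite:
  assumes "pair_graph H" "card (pverts H) < 2" shows "monotone_bipartite H"
proof -
  interpret pair_graph H by fact
  have "parcs H = {}"
  proof (rule equals0I)
    fix e assume e: "e \<in> parcs H"
    have "{fst e, snd e} \<subseteq> pverts H" using e arc_fst_in_verts arc_snd_in_verts by auto
    then have "card {fst e, snd e} \<le> card (pverts H)" by (intro card_mono pair_finite_verts)
    moreover have "fst e \<noteq> snd e" using e pair_no_loops by blast
    ultimately show False using assms(2) by simp
  qed
  then show ?thesis unfolding monotone_bipartite_def by (intro exI[of _ "pverts H"] exI[of _ "{}"]) auto
qed

lemma root_quotient_monotone_bipartite:
  assumes fin: "finite (pverts G)" and big: "2 \<le> card (pverts G)"
  shows "monotone_bipartite (quotient_graph G [pverts G])"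
proof -
  let ?V = "pverts G" and ?r = "[pverts G]"
  let ?m = "Min ?V"
  have mod: "is_module G ?V" by (auto simp: is_module_def)
  have ch: "children G ?r = {[{?m}, ?V], [?V - {?m}, ?V]}"
    using big mod by (auto simp: children_def child_sets_def)
  have fr: "finite (hd ?r)" using fin by simp
  let ?H = "quotient_graph G ?r"
  define A where "A = {y \<in> grandchildren G ?r. tl y = [{?m}, ?V]}"
  define B where "B = {y \<in> grandchildren G ?r. tl y = [?V - {?m}, ?V]}"
  have AB: "grandchildren G ?r = A \<union> B"
    using grandchildrenD(1)[OF fr, where G = G] ch unfolding A_def B_def by blast
  have A: "Min (hd y) = ?m" if "y \<in> A" for y
    using grandchildrenD(4,7)[OF fr, of y G] that by (auto simp: A_def B_def)
  have B: "?m < Min (hd y)" if "y \<in> B" for y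
  proof -
    have "Min (hd y) \<in> ?V - {?m}" using grandchildrenD(4,7)[OF fr, of y G] that by (auto simp: A_def B_def)
    then show ?thesis using fin by (auto simp: order.strict_iff_order)
  qed
  let ?X = "(\<lambda>y. Min (hd y)) ` A" and ?Y = "(\<lambda>y. Min (hd y)) ` B"
  show ?thesis
    unfolding monotone_bipartite_def
  proof (intro exI conjI)
    show "pverts ?H = ?X \<union> ?Y"
      using AB by (simp add: quotient_graph_def node_graph_def image_Un)
    show "\<forall>u\<in>?X. \<forall>v\<in>?Y. u < v" using A B by auto
    show "\<forall>(u, v)\<in>parcs ?H. u \<in> ?X \<and> v \<in> ?Y \<or> u \<in> ?Y \<and> v \<in> ?X"
    proof (clarify)
      fix u v assume "(u, v) \<in> parcs ?H" and n: "\<not> (u \<in> ?Y \<and> v \<in> ?X)"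
      then obtain y y' where y: "u = Min (hd y)" "v = Min (hd y')"
        "y \<in> grandchildren G ?r" "y' \<in> grandchildren G ?r" "tl y \<noteq> tl y'"
        by (auto simp: quotient_graph_def node_graph_def quotient_adj_def)
      have "y \<in> A \<or> y \<in> B" "y' \<in> A \<or> y' \<in> B"
        using y(3,4) AB by auto
      then have "y \<in> A \<and> y' \<in> B \<or> y \<in> B \<and> y' \<in> A" using y(5) by (auto simp: A_def B_def)
      then show "u \<in> ?X \<and> v \<in> ?Y" using n y(1,2) by blast
    qed
  qed
qed

lemma refined_quotients_smaller:
  assumes "pair_graph G" "\<not> monotone_bipartite G"
    and "H \<in> refined_quotients G" "\<not> monotone_bipartite H"
  shows "card (pverts H) < card (pverts G)"
proof -
  interpret pair_graph G by fact
  have big: "2 \<le> card (pverts G)" using small_monotone_bipartite[OF assms(1)] assms(2) by force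
  obtain x where x: "x \<in> nodes G" "H \<in> refined_quotients_at G x"
    using assms(3) by (auto simp: refined_quotients_def)
  have np: "hd x \<subseteq> pverts G" "x = [pverts G] \<or> hd x \<noteq> pverts G"
    using nodes_props[OF pair_finite_verts x(1)] big by auto
  have fin: "finite (hd x)" using np pair_finite_verts finite_subset by blast
  from x(2) show ?thesis
  proof (cases rule: refined_quotients_at_cases)
    case 1
    then show ?thesis using assms(4) by simp
  next
    case (2 C D t)
    then have "x \<noteq> [pverts G]"
      using root_quotient_monotone_bipartite[OF pair_finite_verts big] by auto
    then have "hd x \<subset> pverts G" using np by auto
    moreover have "pverts H \<subseteq> hd x"
      unfolding 2 class_graph_def by (rule node_graph_verts[OF fin trimmed_nodes_subset])
    ultimately show ?thesis by (intro psubset_card_mono pair_finite_verts) auto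
  qed
qed

text \<open>
  The test for \<open>pair_graph\<close> only makes the function total; by \<open>refined_quotients_props\<close> it holds for
  every graph reached from an ordered graph, and by \<open>refined_quotients_finite_nonempty\<close> the
  maximum is over a finite nonempty set.
\<close>

function delayed_rank :: "'a::linorder pair_pre_digraph \<Rightarrow> nat" where
  "delayed_rank G =
     (if \<not> pair_graph G \<or> monotone_bipartite G then 0
      else 1 + Max (delayed_rank ` refined_quotients G))"
  by auto
termination
proof (relation "measure (\<lambda>G. if \<not> pair_graph G \<or> monotone_bipartite G then 0 else card (pverts G))",
    goal_cases)
  case 1
  then show ?case by simp
next
  case (2 G H)
  then have G: "pair_graph G" "\<not> monotone_bipartite G" by auto
  have "card (pverts G) > 0" using small_monotone_bipartite[of G] G by force
  then show ?case using refined_quotients_smaller[OF G 2(2)] G by auto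
qed

declare delayed_rank.simps [simp del]

lemma refined_quotients_finite_nonempty:
  assumes "pair_graph G"
  shows "finite (refined_quotients G)" "refined_quotients G \<noteq> {}"
proof -
  interpret pair_graph G by fact
  let ?f = "\<lambda>(V, E). \<lparr>pverts = V, parcs = E\<rparr>"
  have "H \<in> ?f ` (Pow (pverts G) \<times> Pow (pverts G \<times> pverts G))" if "H \<in> refined_quotients G" for H
  proof -
    interpret H: pair_graph H using refined_quotients_props(1)[OF assms that] .
    have "parcs H \<subseteq> pverts H \<times> pverts H"
      using H.in_arcsD1 H.in_arcsD2 by auto
    then have "H = ?f (pverts H, parcs H)" "pverts H \<subseteq> pverts G" "parcs H \<subseteq> pverts G \<times> pverts G"
      using refined_quotients_props(2)[OF assms that] by auto
    then show ?thesis by blast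
  qed
  then show "finite (refined_quotients G)"
    by (rule finite_subset[OF subsetI]) (use pair_finite_verts in auto)
  have "refined_quotients_at G [pverts G] \<noteq> {}" by (simp add: refined_quotients_at_def)
  then show "refined_quotients G \<noteq> {}" using nodes.root[of G] by (auto simp: refined_quotients_def)
qed

end

theory Submission
  imports Defs
begin

text \<open>
  We show more: the \<open>r\<close> intervals can be chosen so that each of them also contains both ends of some
  edge. Let \<open>H\<close> be a refined quotient graph of \<open>G\<close> at the node \<open>x\<close> that is trimmed to the type
  \<open>t \<in> {L, R}\<close>. A vertex of \<open>H\<close> of type \<open>t\<close> has a neighbour in \<open>G\<close> beyond \<open>L(x)\<close>, on the side
  given by \<open>t\<close>; every edge of \<open>H\<close> spans a vertex of type \<open>t\<close>; and by trimming the first and the last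
  vertex of \<open>H\<close> have type \<open>t\<close>. Hence every interval of \<open>H\<close> containing an edge is adjacent to the set
  of vertices of \<open>G\<close> beyond \<open>L(x)\<close> on side \<open>t\<close>, so that this set is a further interval. It need not
  contain an edge itself, but among three successive levels two have the same side: the inner one
  supplies the new interval, and for the outer one this interval, which contains an extreme vertex
  of the refined quotient graph, is joined to the vertices beyond and so gets an edge.
\<close>

subsection \<open>Monotone colourings\<close>

text \<open>
  A partition into \<open>k\<close> intervals is encoded as a monotone map to \<open>{..<k}\<close>; the colour classes in \<open>S\<close>
  are required to contain an edge.
\<close>

definition clique_colouring ::
  "'a::linorder pair_pre_digraph \<Rightarrow> nat \<Rightarrow> nat set \<Rightarrow> ('a \<Rightarrow> nat) \<Rightarrow> bool" where
  "clique_colouring G k S f \<longleftrightarrow>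
     mono_on (pverts G) f \<and> f ` pverts G \<subseteq> {..<k} \<and>
     (\<forall>i j. i \<le> j \<longrightarrow> j < k \<longrightarrow> i < j \<or> i \<in> S \<longrightarrow>
        (\<exists>u v. (u, v) \<in> parcs G \<and> f u = i \<and> f v = j))"

lemma clique_colouringI:
  assumes "\<And>u v. u \<in> pverts G \<Longrightarrow> v \<in> pverts G \<Longrightarrow> u \<le> v \<Longrightarrow> f u \<le> f v"
    and "\<And>u. u \<in> pverts G \<Longrightarrow> f u < k"
    and "\<And>i j. i \<le> j \<Longrightarrow> j < k \<Longrightarrow> i < j \<or> i \<in> S \<Longrightarrow> \<exists>u v. (u, v) \<in> parcs G \<and> f u = i \<and> f v = j"
  shows "clique_colouring G k S f"
  unfolding clique_colouring_def mono_on_def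
  by (intro conjI allI impI image_subsetI) (simp_all add: assms)

lemma clique_colouringD:
  assumes "clique_colouring G k S f"
  shows "u \<in> pverts G \<Longrightarrow> v \<in> pverts G \<Longrightarrow> u \<le> v \<Longrightarrow> f u \<le> f v"
    and "u \<in> pverts G \<Longrightarrow> f u < k"
    and "i \<le> j \<Longrightarrow> j < k \<Longrightarrow> i < j \<or> i \<in> S \<Longrightarrow> \<exists>u v. (u, v) \<in> parcs G \<and> f u = i \<and> f v = j"
  using assms unfolding clique_colouring_def mono_on_def image_subset_iff lessThan_iff
  by simp_all metis

lemma pair_graph_symD:
  assumes "pair_graph G" "(u, v) \<in> parcs G" shows "(v, u) \<in> parcs G"
proof -
  interpret pair_graph G by fact
  show ?thesis using pair_sym_arcs assms(2) by (auto simp: symmetric_def dest: symD)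
qed

lemma pair_graph_vertsD:
  assumes "pair_graph G" "(u, v) \<in> parcs G" shows "u \<in> pverts G" "v \<in> pverts G"
proof -
  interpret pair_graph G by fact
  show "u \<in> pverts G" "v \<in> pverts G" using in_arcsD1 in_arcsD2 assms(2) by auto
qed

lemma pair_graph_finite: "pair_graph G \<Longrightarrow> finite (pverts G)"
  using pair_fin_digraph.pair_finite_verts pair_graph.axioms(1) pair_digraph.axioms(1) by blast

text \<open>The colour classes \<open>F i\<close> are the parts, and they are intervals because
  \<open>f\<close> is monotone. The edge inside each class makes it nonempty, which gives nonempty
  parts and injectivity of \<open>F\<close>, hence exactly \<open>r\<close> parts.\<close>

lemma complete_interval_minor_if_clique_colouring:
  assumes G: "pair_graph G" and f: "clique_colouring G r {..<r} f"
  shows "has_complete_interval_minor G r"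
proof -
  define F where "F i = {v \<in> pverts G. f v = i}" for i
  have edge: "\<exists>u\<in>F i. \<exists>v\<in>F j. (u, v) \<in> parcs G" if "i < r" "j < r" for i j
  proof (cases "i \<le> j")
    case True
    then show ?thesis
      using clique_colouringD(3)[OF f, of i j] that pair_graph_vertsD[OF G] by (fastforce simp: F_def)
  next
    case False
    then show ?thesis
      using clique_colouringD(3)[OF f, of j i] that pair_graph_vertsD[OF G] pair_graph_symD[OF G]
      by (fastforce simp: F_def)
  qed
  have ne: "F i \<noteq> {}" if "i < r" for i using edge[OF that that] by blast
  have inj: "inj_on F {..<r}"
    by (rule inj_onI) (use ne in \<open>fastforce simp: F_def\<close>)
  have "partition_on (pverts G) (F ` {..<r})"
  proof (rule partition_onI)
    show "\<Union> (F ` {..<r}) = pverts G"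
      using clique_colouringD(2)[OF f] by (auto simp: F_def)
  qed (use ne in \<open>auto simp: F_def disjnt_def\<close>)
  moreover have "interval_of (pverts G) (F i)" for i
    unfolding interval_of_def F_def
    by (auto intro!: antisym dest: clique_colouringD(1)[OF f])
  ultimately show ?thesis
    unfolding has_complete_interval_minor_def using edge inj
    by (intro exI[of _ "F ` {..<r}"]) (auto simp: card_image)
qed


subsection \<open>Adding an interval at one level\<close>

text \<open>For \<open>v\<close> in \<open>W\<close> this is the stretch from \<open>v\<close> up
  to, but excluding, the next element of \<open>W\<close>. When nodes are represented by their least
  vertices, the whole set of a node lies in the block of its representative.\<close>

definition block :: "'a::linorder set \<Rightarrow> 'a \<Rightarrow> 'a set" where
  "block W v = {u. v \<le> u \<and> (\<forall>w\<in>W. w \<le> u \<longrightarrow> w \<le> v)}"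

text \<open>Each block inherits the colour of its first element. Everything before \<open>W\<close>
  gets the least colour 0, so the extension stays monotone on the whole type.\<close>

definition lift_colouring :: "'a::linorder set \<Rightarrow> ('a \<Rightarrow> nat) \<Rightarrow> 'a \<Rightarrow> nat" where
  "lift_colouring W f u = (if \<exists>w\<in>W. w \<le> u then f (Max {w \<in> W. w \<le> u}) else 0)"

lemma lift_colouring_block:
  assumes "finite W" "v \<in> W" "u \<in> block W v"
  shows "lift_colouring W f u = f v"
proof -
  have "Max {w \<in> W. w \<le> u} = v" using assms by (intro Max_eqI) (auto simp: block_def)
  then show ?thesis using assms by (auto simp: lift_colouring_def block_def)
qed

lemma lift_colouring_mono:
  assumes "finite W" "\<And>u v. u \<in> W \<Longrightarrow> v \<in> W \<Longrightarrow> u \<le> v \<Longrightarrow> f u \<le> f v" "u \<le> v"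
  shows "lift_colouring W f u \<le> lift_colouring W f v"
proof (cases "\<exists>w\<in>W. w \<le> u")
  case True
  then have ne: "{w \<in> W. w \<le> u} \<noteq> {}" "{w \<in> W. w \<le> v} \<noteq> {}" using assms(3) by force+
  have fin: "finite {w \<in> W. w \<le> u}" "finite {w \<in> W. w \<le> v}" using assms(1) by auto
  have "Max {w \<in> W. w \<le> u} \<le> Max {w \<in> W. w \<le> v}"
    using assms(3) by (intro Max_mono ne fin) auto
  then have "f (Max {w \<in> W. w \<le> u}) \<le> f (Max {w \<in> W. w \<le> v})"
    using Max_in[OF fin(1) ne(1)] Max_in[OF fin(2) ne(2)] by (intro assms(2)) auto
  then show ?thesis using ne by (auto simp: lift_colouring_def)
qed (simp add: lift_colouring_def)

lemma lift_colouring_less: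
  assumes "finite W" "\<And>u. u \<in> W \<Longrightarrow> f u < k" "0 < k"
  shows "lift_colouring W f u < k"
proof (cases "\<exists>w\<in>W. w \<le> u")
  case True
  then have "Max {w \<in> W. w \<le> u} \<in> {w \<in> W. w \<le> u}" using assms(1) by (intro Max_in) auto
  then show ?thesis using True assms(2) by (simp add: lift_colouring_def)
qed (use assms(3) in \<open>simp add: lift_colouring_def\<close>)

text \<open>
  \<open>A\<close> plays the role of \<open>L(x)\<close>, \<open>T\<close> of the set of vertices of type \<open>t\<close>, and \<open>X\<close> of the set of
  vertices beyond \<open>L(x)\<close> on the side given by \<open>t\<close>.
\<close>

locale collapse =
  fixes G H :: "'a::linorder pair_pre_digraph" and A T X :: "'a set"
  assumes G: "pair_graph G" and H: "pair_graph H"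
    and HA: "pverts H \<subseteq> A" and TH: "T \<subseteq> pverts H"
    and edge: "\<And>u v. (u, v) \<in> parcs H \<Longrightarrow>
      \<exists>u' \<in> A \<inter> block (pverts H) u. \<exists>v' \<in> A \<inter> block (pverts H) v. (u', v') \<in> parcs G"
    and outer: "\<And>t. t \<in> T \<Longrightarrow> \<exists>u \<in> A \<inter> block (pverts H) t. \<exists>w\<in>X. (w, u) \<in> parcs G"
    and spanned: "\<And>u v. (u, v) \<in> parcs H \<Longrightarrow> \<exists>t\<in>T. min u v \<le> t \<and> t \<le> max u v"
begin

abbreviation lift :: "('a \<Rightarrow> nat) \<Rightarrow> 'a \<Rightarrow> nat" where
  "lift \<equiv> lift_colouring (pverts H)"

lemmas fin = pair_graph_finite[OF H]

lemma lift_mono: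
  assumes "clique_colouring H k S f" "u \<le> v" shows "lift f u \<le> lift f v"
  by (rule lift_colouring_mono[OF fin clique_colouringD(1)[OF assms(1)] assms(2)])

lemma lift_less:
  assumes "clique_colouring H k S f" "0 < k" shows "lift f u < k"
  by (rule lift_colouring_less[OF fin clique_colouringD(2)[OF assms(1)] assms(2)])

lemma lift_edge:
  assumes f: "clique_colouring H k S f" and "i \<le> j" "j < k" "i < j \<or> i \<in> S"
  shows "\<exists>u\<in>A. \<exists>v\<in>A. (u, v) \<in> parcs G \<and> lift f u = i \<and> lift f v = j"
proof -
  obtain u v where uv: "(u, v) \<in> parcs H" "f u = i" "f v = j"
    using clique_colouringD(3)[OF f] assms(2-) by blast
  obtain u' v' where "u' \<in> A \<inter> block (pverts H) u" "v' \<in> A \<inter> block (pverts H) v"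
    "(u', v') \<in> parcs G"
    using edge[OF uv(1)] by blast
  then show ?thesis
    using lift_colouring_block[OF fin] pair_graph_vertsD[OF H uv(1)] uv(2,3) by blast
qed

text \<open>The edge inside class \<open>j\<close> spans some \<open>t\<close> in \<open>T\<close>,
  and monotonicity forces colour \<open>j\<close> on \<open>t\<close>. The block of \<open>t\<close>
  then contains a vertex with a neighbour in \<open>X\<close>.\<close>

lemma lift_outer_edge:
  assumes f: "clique_colouring H k {..<k} f" and j: "j < k"
  shows "\<exists>w\<in>X. \<exists>u\<in>A. (w, u) \<in> parcs G \<and> lift f u = j"
proof -
  obtain u v where uv: "(u, v) \<in> parcs H" "f u = j" "f v = j"
    using clique_colouringD(3)[OF f, of j j] j by blast
  obtain t where t: "t \<in> T" "min u v \<le> t" "t \<le> max u v" using spanned[OF uv(1)] by blast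
  have uvt: "u \<in> pverts H" "v \<in> pverts H" "t \<in> pverts H"
    using pair_graph_vertsD[OF H uv(1)] t TH by auto
  have "f (min u v) \<le> f t" "f t \<le> f (max u v)"
    using clique_colouringD(1)[OF f] uvt t by (auto simp: min_def max_def)
  then have "f t = j" using uv(2,3) by (simp add: min_def max_def split: if_splits)
  then show ?thesis
    using outer[OF t(1)] lift_colouring_block[OF fin uvt(3)] by blast
qed

lemma clique_colouring_lift:
  assumes "clique_colouring H k S f" "0 < k"
  shows "clique_colouring G k S (lift f)"
proof (rule clique_colouringI)
  show "lift f u \<le> lift f v" if "u \<le> v" for u v by (rule lift_mono[OF assms(1) that])
  show "lift f u < k" for u by (rule lift_less[OF assms])
  show "\<exists>u v. (u, v) \<in> parcs G \<and> lift f u = i \<and> lift f v = j"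
    if "i \<le> j" "j < k" "i < j \<or> i \<in> S" for i j
    using lift_edge[OF assms(1) that] by blast
qed

end

text \<open>The node and the label behind \<open>A\<close> and \<open>T\<close> are hidden, so that
  levels compose without reference to the tree. That an extreme vertex lies in \<open>T\<close> is
  the effect of trimming; it serves to put an edge into the outermost class.\<close>

definition left_level :: "'a::linorder pair_pre_digraph \<Rightarrow> 'a pair_pre_digraph \<Rightarrow> bool" where
  "left_level G H \<longleftrightarrow>
     (\<exists>A T. collapse G H A T {w. \<forall>a\<in>A. w < a} \<and> Min (pverts H) \<in> T)"

definition right_level :: "'a::linorder pair_pre_digraph \<Rightarrow> 'a pair_pre_digraph \<Rightarrow> bool" where
  "right_level G H \<longleftrightarrow>
     (\<exists>A T. collapse G H A T {w. \<forall>a\<in>A. a < w} \<and> Max (pverts H) \<in> T)"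

lemma level_lift:
  assumes "left_level G H \<or> right_level G H" "clique_colouring H k S f" "0 < k"
  shows "\<exists>g. clique_colouring G k S g"
proof -
  obtain A T X where "collapse G H A T X"
    using assms(1) unfolding left_level_def right_level_def by metis
  then show ?thesis using collapse.clique_colouring_lift[OF _ assms(2,3)] by metis
qed

text \<open>The vertices before \<open>A\<close> form a new class 0, and all other colours move up
  by one. Every old class contains an edge, hence sees the new class; the new class itself may
  contain no edge, so 0 is left out of the loop set.\<close>

lemma left_level_new_colour:
  assumes "left_level G H" and f: "clique_colouring H k {..<k} f" and k: "0 < k"
  shows "\<exists>g. clique_colouring G (Suc k) {1..<Suc k} g"
proof -
  obtain A T where "collapse G H A T {w. \<forall>a\<in>A. w < a}"
    using assms(1) unfolding left_level_def by (elim exE conjE)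
  then interpret collapse G H A T "{w. \<forall>a\<in>A. w < a}" .
  define g where "g u = (if \<forall>a\<in>A. u < a then 0 else Suc (lift f u))" for u
  have gA: "g a = Suc (lift f a)" if "a \<in> A" for a using that by (auto simp: g_def)
  have "clique_colouring G (Suc k) {1..<Suc k} g"
  proof (rule clique_colouringI)
    show "g u \<le> g v" if "u \<le> v" for u v
      using lift_mono[OF f that] order.strict_trans1[OF that] by (auto simp: g_def)
    show "g u < Suc k" for u using lift_less[OF f k] by (simp add: g_def)
    fix i j :: nat assume ij: "i \<le> j" "j < Suc k" "i < j \<or> i \<in> {1..<Suc k}"
    then obtain j' where j: "j = Suc j'" "j' < k" by (cases j) auto
    show "\<exists>u v. (u, v) \<in> parcs G \<and> g u = i \<and> g v = j"
    proof (cases i)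
      case 0
      obtain w u where "w \<in> {w. \<forall>a\<in>A. w < a}" "u \<in> A" "(w, u) \<in> parcs G" "lift f u = j'"
        using lift_outer_edge[OF f j(2)] by blast
      then have "(w, u) \<in> parcs G" "g w = i" "g u = j" using 0 j gA by (auto simp: g_def)
      then show ?thesis by blast
    next
      case (Suc i')
      then show ?thesis using lift_edge[OF f, of i' j'] ij j gA by fastforce
    qed
  qed
  then show ?thesis by blast
qed

text \<open>Mirror image with the new class on top: it gets colour \<open>k\<close>, the old colours
  stay, and \<open>k\<close> is the colour missing from the loop set.\<close>

lemma right_level_new_colour:
  assumes "right_level G H" and f: "clique_colouring H k {..<k} f" and k: "0 < k"
  shows "\<exists>g. clique_colouring G (Suc k) {..<k} g"
proof -
  obtain A T where "collapse G H A T {w. \<forall>a\<in>A. a < w}"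
    using assms(1) unfolding right_level_def by (elim exE conjE)
  then interpret collapse G H A T "{w. \<forall>a\<in>A. a < w}" .
  define g where "g u = (if \<forall>a\<in>A. a < u then k else lift f u)" for u
  have gA: "g a = lift f a" if "a \<in> A" for a using that by (auto simp: g_def)
  have "clique_colouring G (Suc k) {..<k} g"
  proof (rule clique_colouringI)
    show "g u \<le> g v" if "u \<le> v" for u v
      using lift_mono[OF f that] lift_less[OF f k, of u] that by (force simp: g_def)
    show "g u < Suc k" for u using lift_less[OF f k, of u] by (simp add: g_def)
    fix i j :: nat assume ij: "i \<le> j" "j < Suc k" "i < j \<or> i \<in> {..<k}"
    then have i: "i < k" by auto
    show "\<exists>u v. (u, v) \<in> parcs G \<and> g u = i \<and> g v = j"
    proof (cases "j = k")
      case True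
      obtain w u where "w \<in> {w. \<forall>a\<in>A. a < w}" "u \<in> A" "(w, u) \<in> parcs G" "lift f u = i"
        using lift_outer_edge[OF f i] by blast
      then have "(u, w) \<in> parcs G" "g u = i" "g w = j"
        using True gA pair_graph_symD[OF G] by (auto simp: g_def)
      then show ?thesis by blast
    next
      case False
      then show ?thesis using lift_edge[OF f, of i j] ij i gA by fastforce
    qed
  qed
  then show ?thesis by blast
qed

text \<open>Since \<open>k\<close> is at least 2, class 0 meets class 1 and is nonempty, so the
  first vertex of \<open>H\<close> has colour 0. That vertex lies in \<open>T\<close>, so its block
  contains an end of an edge from before \<open>A\<close>, and this edge lies inside class 0 of the
  lifted colouring.\<close>

lemma left_level_new_loop:
  assumes "left_level G H" and f: "clique_colouring H k {1..<k} f" and k: "2 \<le> k"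
  shows "\<exists>g. clique_colouring G k {..<k} g"
proof -
  obtain A T where "collapse G H A T {w. \<forall>a\<in>A. w < a}" and m: "Min (pverts H) \<in> T"
    using assms(1) unfolding left_level_def by (elim exE conjE)
  then interpret collapse G H A T "{w. \<forall>a\<in>A. w < a}" by blast
  let ?m = "Min (pverts H)"
  have mH: "?m \<in> pverts H" using m TH by blast
  obtain u v where "(u, v) \<in> parcs H" "f u = 0"
    using clique_colouringD(3)[OF f, of 0 1] k by auto
  then have "f ?m \<le> 0"
    using clique_colouringD(1)[OF f mH, of u] pair_graph_vertsD[OF H] fin by force
  moreover obtain u w where u: "u \<in> A" "u \<in> block (pverts H) ?m" "\<forall>a\<in>A. w < a" "(w, u) \<in> parcs G"
    using outer[OF m] by blast
  ultimately have lu: "lift f u = 0" using lift_colouring_block[OF fin mH u(2)] by simp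
  \<comment> \<open>As \<open>w\<close> lies before \<open>u\<close>, monotonicity bounds its colour
    by that of \<open>u\<close>, which is already the least one.\<close>
  moreover have "lift f w = 0" using lift_mono[OF f, of w u] u lu by force
  ultimately have "\<exists>u v. (u, v) \<in> parcs G \<and> lift f u = 0 \<and> lift f v = 0" using u(4) by blast
  moreover have c: "clique_colouring G k {1..<k} (lift f)"
    using clique_colouring_lift[OF f] k by simp
  ultimately have "clique_colouring G k {..<k} (lift f)"
  proof (intro clique_colouringI)
    fix i j assume "i \<le> j" "j < k" "i < j \<or> i \<in> {..<k}"
    then show "\<exists>u v. (u, v) \<in> parcs G \<and> lift f u = i \<and> lift f v = j"
      using clique_colouringD(3)[OF c, of i j] \<open>\<exists>u v. _ \<and> lift f u = 0 \<and> lift f v = 0\<close>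
      by (cases "j = 0") (simp_all, force)
  qed (use clique_colouringD[OF c] in blast)+
  then show ?thesis by blast
qed

text \<open>Mirror image for the top colour \<open>k\<close>: there are \<open>Suc k\<close>
  colours, and \<open>1 \<le> k\<close> provides a class 0 below \<open>k\<close> whose edge to
  class \<open>k\<close> shows that the latter is nonempty.\<close>

lemma right_level_new_loop:
  assumes "right_level G H" and f: "clique_colouring H (Suc k) {..<k} f" and k: "1 \<le> k"
  shows "\<exists>g. clique_colouring G (Suc k) {..<Suc k} g"
proof -
  obtain A T where "collapse G H A T {w. \<forall>a\<in>A. a < w}" and m: "Max (pverts H) \<in> T"
    using assms(1) unfolding right_level_def by (elim exE conjE)
  then interpret collapse G H A T "{w. \<forall>a\<in>A. a < w}" by blast
  let ?m = "Max (pverts H)"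
  have mH: "?m \<in> pverts H" using m TH by blast
  obtain u v where "(u, v) \<in> parcs H" "f v = k"
    using clique_colouringD(3)[OF f, of 0 k] k by auto
  then have "k \<le> f ?m"
    using clique_colouringD(1)[OF f _ mH, of v] pair_graph_vertsD[OF H] fin by force
  then have fm: "f ?m = k" using clique_colouringD(2)[OF f mH] by simp
  obtain u w where u: "u \<in> A" "u \<in> block (pverts H) ?m" "\<forall>a\<in>A. a < w" "(w, u) \<in> parcs G"
    using outer[OF m] by blast
  have lu: "lift f u = k" using lift_colouring_block[OF fin mH u(2)] fm by simp
  moreover have "lift f w = k"
    using lift_mono[OF f, of u w] lift_less[OF f, of w] u lu by force
  ultimately have loop: "\<exists>u v. (u, v) \<in> parcs G \<and> lift f u = k \<and> lift f v = k" using u(4) by blast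
  have c: "clique_colouring G (Suc k) {..<k} (lift f)"
    using clique_colouring_lift[OF f] by simp
  have "clique_colouring G (Suc k) {..<Suc k} (lift f)"
  proof (intro clique_colouringI)
    fix i j assume "i \<le> j" "j < Suc k" "i < j \<or> i \<in> {..<Suc k}"
    then show "\<exists>u v. (u, v) \<in> parcs G \<and> lift f u = i \<and> lift f v = j"
      using clique_colouringD(3)[OF c, of i j] loop by (cases "i = k \<and> j = k") auto
  qed (use clique_colouringD[OF c] in blast)+
  then show ?thesis by blast
qed

text \<open>Two of the three levels lie on the same side; the six cases record this pair and its
  side. The inner level of the pair adds a class, the outer one puts an edge into it, and the
  remaining level, wherever it stands, merely lifts the colouring.\<close>

lemma three_levels:
  assumes lev: "left_level G G1 \<or> right_level G G1" "left_level G1 G2 \<or> right_level G1 G2"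
      "left_level G2 G3 \<or> right_level G2 G3"
    and f: "clique_colouring G3 k {..<k} f" and k: "0 < k"
  shows "\<exists>g. clique_colouring G (Suc k) {..<Suc k} g"
proof -
  have k2: "2 \<le> Suc k" "1 \<le> k" "0 < Suc k" using k by auto
  have up: "\<exists>g. clique_colouring G' k' S g"
    if "left_level G' H' \<or> right_level G' H'" "\<exists>f. clique_colouring H' k' S f" "0 < k'"
    for G' H' :: "'a pair_pre_digraph" and k' S
    using that level_lift by blast
  have newL: "\<exists>g. clique_colouring G' (Suc k) {1..<Suc k} g"
    if "left_level G' H'" "\<exists>f. clique_colouring H' k {..<k} f" for G' H' :: "'a pair_pre_digraph"
    using that left_level_new_colour k by blast
  have newR: "\<exists>g. clique_colouring G' (Suc k) {..<k} g"
    if "right_level G' H'" "\<exists>f. clique_colouring H' k {..<k} f" for G' H' :: "'a pair_pre_digraph"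
    using that right_level_new_colour k by blast
  have loopL: "\<exists>g. clique_colouring G' (Suc k) {..<Suc k} g"
    if "left_level G' H'" "\<exists>f. clique_colouring H' (Suc k) {1..<Suc k} f"
    for G' H' :: "'a pair_pre_digraph"
    using that left_level_new_loop k2(1) by blast
  have loopR: "\<exists>g. clique_colouring G' (Suc k) {..<Suc k} g"
    if "right_level G' H'" "\<exists>f. clique_colouring H' (Suc k) {..<k} f"
    for G' H' :: "'a pair_pre_digraph"
    using that right_level_new_loop k2(2) by blast
  have f': "\<exists>f. clique_colouring G3 k {..<k} f" using f by blast
  consider "left_level G G1" "left_level G1 G2" | "left_level G G1" "left_level G2 G3"
    | "left_level G1 G2" "left_level G2 G3" | "right_level G G1" "right_level G1 G2"
    | "right_level G G1" "right_level G2 G3" | "right_level G1 G2" "right_level G2 G3"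
    using lev by blast
  then show ?thesis
  proof cases
    case 1 show ?thesis by (rule loopL[OF 1(1) newL[OF 1(2) up[OF lev(3) f' k]]])
  next
    case 2 show ?thesis by (rule loopL[OF 2(1) up[OF lev(2) newL[OF 2(2) f'] k2(3)]])
  next
    case 3 show ?thesis by (rule up[OF lev(1) loopL[OF 3(1) newL[OF 3(2) f']] k2(3)])
  next
    case 4 show ?thesis by (rule loopR[OF 4(1) newR[OF 4(2) up[OF lev(3) f' k]]])
  next
    case 5 show ?thesis by (rule loopR[OF 5(1) up[OF lev(2) newR[OF 5(2) f'] k2(3)]])
  next
    case 6 show ?thesis by (rule up[OF lev(1) loopR[OF 6(1) newR[OF 6(2) f']] k2(3)])
  qed
qed


subsection \<open>Order of the nodes\<close>

lemma interval_of_disjoint_less: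
  assumes "interval_of V I" "interval_of V J" "I \<inter> J = {}"
    and "a \<in> I" "b \<in> J" "a < b" "u \<in> I" "v \<in> J"
  shows "u < v"
proof (rule ccontr)
  have V: "a \<in> V" "b \<in> V" "u \<in> V" "v \<in> V"
    using assms(1,2,4,5,7,8) unfolding interval_of_def by blast+
  assume "\<not> u < v"
  then have vu: "v \<le> u" by simp
  show False
  proof (cases "a \<le> v")
    case True
    then have "v \<in> I" using assms(1,4,7) V vu unfolding interval_of_def by blast
    then show False using assms(3,8) by blast
  next
    case False
    then have "v \<le> a" "a \<le> b" using assms(6) by auto
    then have "a \<in> J" using assms(2,5,8) V unfolding interval_of_def by blast
    then show False using assms(3,4) by blast
  qed
qed

lemma node_less_total:
  assumes "interval_of V (hd y)" "interval_of V (hd z)" "hd y \<inter> hd z = {}"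
    and "hd y \<noteq> {}" "hd z \<noteq> {}"
  shows "node_less y z \<or> node_less z y"
proof -
  obtain a b where ab: "a \<in> hd y" "b \<in> hd z" using assms(4,5) by blast
  then have "a < b \<or> b < a" using assms(3) by (metis disjoint_iff neqE)
  then show ?thesis
    using interval_of_disjoint_less[OF assms(1-3) ab]
      interval_of_disjoint_less[OF assms(2,1) _ ab(2,1)] assms(3)
    unfolding node_less_def by (metis inf_commute)
qed

text \<open>The only delicate case is a twin class: the twin relation constrains all vertices
  between its two arguments, so a vertex between two twins is itself a twin of both.\<close>

lemma interval_of_child:
  assumes fin: "finite (hd x)" and int: "interval_of (pverts G) (hd x)" and y: "y \<in> children G x"
  shows "interval_of (pverts G) (hd y)"
proof -
  let ?A = "hd x" and ?V = "pverts G"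
  have sub: "?A \<subseteq> ?V" using int by (simp add: interval_of_def)
  have conv: "c \<in> ?A" if "a \<in> ?A" "b \<in> ?A" "c \<in> ?V" "a \<le> c" "c \<le> b" for a b c
    using int that unfolding interval_of_def by blast
  have y': "hd y \<in> child_sets G x" using y by (auto simp: children_def)
  consider "hd y = {Min ?A}" "?A \<noteq> {}" | "hd y = ?A - {Min ?A}" | "hd y = ?A"
    | "hd y \<in> ?A // twin_rel G ?A"
    using y' by (cases "?A = {}") (auto simp: child_sets_def split: if_splits)
  then show ?thesis
  proof cases
    case 1
    then show ?thesis using sub Min_in[OF fin] by (auto simp: interval_of_def)
  next
    case 2
    have "c \<noteq> Min ?A" if "a \<in> ?A" "a \<noteq> Min ?A" "a \<le> c" for a c
      using Min_le[OF fin that(1)] that by auto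
    then show ?thesis using sub conv unfolding interval_of_def 2 by blast
  next
    case 3
    then show ?thesis using int by simp
  next
    case 4
    have eq: "equiv ?A (twin_rel G ?A)" by (rule equiv_twin_rel[OF sub])
    have yA: "hd y \<subseteq> ?A" using childrenD(3)[OF fin y] .
    have "c \<in> hd y" if c: "a \<in> hd y" "b \<in> hd y" "c \<in> ?V" "a \<le> c" "c \<le> b" for a b c
    proof -
      have ab: "(a, b) \<in> twin_rel G ?A" using quotient_eq_iff[OF eq 4 4 c(1,2)] by simp
      have "c \<in> ?A" using conv c yA by blast
      moreover have "outside_nbhd G ?A w = outside_nbhd G ?A a"
        if "w \<in> ?V" "a \<le> w" "w \<le> b" for w
        using ab that by (auto simp: twin_rel_def min_absorb1 max_absorb2)
      ultimately have "(a, c) \<in> twin_rel G ?A"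
        using c yA by (auto simp: twin_rel_def min_def max_def)
      then show ?thesis using in_quotient_imp_closed[OF eq 4 c(1)] by blast
    qed
    then show ?thesis using yA sub unfolding interval_of_def by blast
  qed
qed

lemma interval_of_node:
  assumes "finite (pverts G)" "x \<in> nodes G"
  shows "interval_of (pverts G) (hd x)"
  using assms(2)
proof induction
  case root
  show ?case by (simp add: interval_of_def)
next
  case (child x y)
  have "finite (hd x)"
    using nodes_props[OF assms(1) child.hyps(1)] assms(1) finite_subset by blast
  then show ?case using interval_of_child child by blast
qed

text \<open>This is what the splitting rules achieve: either all of \<open>hd x\<close> is a module,
  or it is a singleton, or its children are twin classes. It allows an edge leaving
  \<open>hd x\<close> to be moved to any other vertex of the same child.\<close>

lemma child_same_outside:
  assumes fin: "finite (hd x)" and sub: "hd x \<subseteq> pverts G" and G: "pair_graph G"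
    and z: "z \<in> children G x" and uv: "u \<in> hd z" "v \<in> hd z"
    and w: "w \<notin> hd x" "(w, u) \<in> parcs G"
  shows "(w, v) \<in> parcs G"
proof -
  let ?A = "hd x"
  have A: "u \<in> ?A" "v \<in> ?A" using childrenD(3)[OF fin z] uv by auto
  have wV: "w \<in> pverts G" using pair_graph_vertsD[OF G w(2)] by simp
  have z': "hd z \<in> child_sets G x" using z by (auto simp: children_def)
  consider "is_module G ?A" | "card ?A = 1" | "hd z \<in> ?A // twin_rel G ?A"
    using z' by (auto simp: child_sets_def split: if_splits)
  then show ?thesis
  proof cases
    case 1
    then show ?thesis using A w wV unfolding is_module_def by blast
  next
    case 2
    then have "u = v" using A by (metis card_1_singletonE singletonD)
    then show ?thesis using w by simp
  next
    case 3
    have "(u, v) \<in> twin_rel G ?A" using quotient_eq_iff[OF equiv_twin_rel[OF sub] 3 3 uv] by simp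
    then have "\<forall>w\<in>pverts G. min u v \<le> w \<and> w \<le> max u v \<longrightarrow>
        outside_nbhd G ?A w = outside_nbhd G ?A v"
      unfolding twin_rel_def by blast
    moreover have "u \<in> pverts G" using A sub by blast
    ultimately have "outside_nbhd G ?A u = outside_nbhd G ?A v" by simp
    moreover have "w \<in> outside_nbhd G ?A u"
      using w wV pair_graph_symD[OF G] by (simp add: outside_nbhd_def)
    ultimately show ?thesis using pair_graph_symD[OF G] by (simp add: outside_nbhd_def)
  qed
qed

text \<open>A label of a child of \<open>x\<close> becomes visible as a type only through
  grandchildren of \<open>x\<close>; this lemma supplies such a grandchild.\<close>

lemma children_nonempty:
  assumes "finite (hd z)" "hd z \<noteq> {}" "\<not> is_leaf z"
  shows "children G z \<noteq> {}"
proof -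
  have "card (hd z) \<noteq> 0" using assms by simp
  then have "card (hd z) = 1 \<or> 2 \<le> card (hd z)" by linarith
  then show ?thesis
    using assms by (auto simp: children_def child_sets_def quotient_def)
qed

text \<open>Two grandchildren are disjoint either as siblings or because their parents are disjoint,
  and disjoint nonempty intervals are comparable.\<close>

lemma grandchildren_total:
  assumes fin: "finite (pverts G)" and x: "x \<in> nodes G"
    and y: "y \<in> grandchildren G x" "y' \<in> grandchildren G x" "y \<noteq> y'"
  shows "node_less y y' \<or> node_less y' y"
proof -
  have int: "interval_of (pverts G) (hd x)" by (rule interval_of_node[OF fin x])
  then have sub: "hd x \<subseteq> pverts G" by (simp add: interval_of_def)
  then have finx: "finite (hd x)" using fin finite_subset by blast
  note yD = grandchildrenD[OF finx y(1)] and y'D = grandchildrenD[OF finx y(2)]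
  have I: "interval_of (pverts G) (hd (tl y))" "interval_of (pverts G) (hd (tl y'))"
    using interval_of_child[OF finx int] yD(1) y'D(1) by auto
  have fz: "finite (hd (tl y))" "finite (hd (tl y'))"
    using childrenD(4)[OF finx] yD(1) y'D(1) by auto
  have "hd y \<inter> hd y' = {}"
  proof (cases "tl y = tl y'")
    case True
    have "hd (tl y) \<subseteq> pverts G" using I(1) by (simp add: interval_of_def)
    then show ?thesis using children_disjoint[of "tl y" G y y'] True yD(2) y'D(2) y(3) by simp
  next
    case False
    then show ?thesis using children_disjoint[OF sub yD(1) y'D(1)] yD(4) y'D(4) by blast
  qed
  then show ?thesis
    using node_less_total interval_of_child[OF fz(1) I(1) yD(2)]
      interval_of_child[OF fz(2) I(2) y'D(2)] yD(3) y'D(3) by blast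
qed


subsection \<open>Labels\<close>

lemma base_label_neq: "base_label G z \<noteq> Lab_OL" "base_label G z \<noteq> Lab_OR"
  by (simp_all add: base_label_def)

text \<open>Relabelling changes \<open>Lab_O\<close> only. Hence the base label of the preceding
  sibling, which decides about \<open>Lab_OL\<close>, can be read as its final label.\<close>

lemma label_L_iff: "label G z = Lab_L \<longleftrightarrow> base_label G z = Lab_L"
  by (auto simp: label_def)

lemma label_R_iff: "label G z = Lab_R \<longleftrightarrow> base_label G z = Lab_R"
  by (auto simp: label_def)

lemma label_OL_preceding:
  "label G z = Lab_OL \<Longrightarrow> \<exists>z0. immediately_precedes G z0 z \<and> label G z0 = Lab_L"
  unfolding label_L_iff by (auto simp: label_def base_label_neq split: if_splits)

lemma label_OR_preceding:
  "label G z = Lab_OR \<Longrightarrow> \<exists>z0. immediately_precedes G z0 z \<and> label G z0 = Lab_R"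
  unfolding label_R_iff by (auto simp: label_def base_label_neq split: if_splits)

text \<open>The parent of a cousin of \<open>z\<close> is a sibling of \<open>x\<close>, hence
  disjoint from \<open>x\<close>, so the edge witnessing the adjacency leaves
  \<open>hd x\<close>.\<close>

lemma cousin_edge_beyond:
  assumes G: "pair_graph G" and x: "x \<in> nodes G" "tl x \<noteq> []" and z: "z \<in> children G x"
    and x': "x' \<in> grandchildren G (tl x)" "quotient_adj G z x'"
  shows "\<exists>u\<in>hd z. \<exists>w\<in>hd x'. w \<notin> hd x \<and> (w, u) \<in> parcs G"
proof -
  have fin: "finite (pverts G)" by (rule pair_graph_finite[OF G])
  obtain p where p: "p \<in> nodes G" "x \<in> children G p"
    using x by (cases rule: nodes.cases) auto
  have sub: "hd x \<subseteq> pverts G" "hd p \<subseteq> pverts G" using nodes_props[OF fin] x p by auto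
  then have finx: "finite (hd x)" and finp: "finite (hd p)" using fin finite_subset by blast+
  have tlx: "tl x = p" and tlz: "tl z = x" using childrenD(1) finp p(2) finx z by blast+
  obtain u w where uw: "u \<in> hd z" "w \<in> hd x'" "(u, w) \<in> parcs G" and ne: "x \<noteq> tl x'"
    using x'(2) tlz by (auto simp: quotient_adj_def)
  note x'D = grandchildrenD[OF finp x'(1)[unfolded tlx]]
  have "hd x \<inter> hd (tl x') = {}" using children_disjoint[OF sub(2) p(2) x'D(1) ne] .
  then have "w \<notin> hd x" using x'D(4) uw(2) by blast
  then show ?thesis using uw pair_graph_symD[OF G] by blast
qed

lemma base_label_not_root:
  assumes "finite (hd x)" "z \<in> children G x" "base_label G z \<noteq> Lab_Empty"
  shows "tl x \<noteq> []"
  using assms(3) childrenD(1)[OF assms(1,2)] by (cases z; cases x) (auto simp: base_label_def)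

lemma label_L_edge:
  assumes G: "pair_graph G" and x: "x \<in> nodes G" and z: "z \<in> children G x" "label G z = Lab_L"
  shows "\<exists>u\<in>hd z. \<exists>w. (\<forall>a\<in>hd x. w < a) \<and> (w, u) \<in> parcs G"
proof -
  have fin: "finite (pverts G)" by (rule pair_graph_finite[OF G])
  have int: "interval_of (pverts G) (hd x)" by (rule interval_of_node[OF fin x])
  then have finx: "finite (hd x)" using fin finite_subset unfolding interval_of_def by blast
  have b: "base_label G z = Lab_L" using z(2) label_L_iff by blast
  then obtain x' where x': "x' \<in> grandchildren G (tl x)" "node_less x' z" "quotient_adj G z x'"
    using childrenD(1)[OF finx z(1)] by (auto simp: base_label_def split: if_splits)
  obtain u w where u: "u \<in> hd z" "w \<in> hd x'" "w \<notin> hd x" "(w, u) \<in> parcs G"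
    using cousin_edge_beyond[OF G x base_label_not_root[OF finx z(1)] z(1) x'(1,3)] b by auto
  have "u \<in> hd x" using childrenD(3)[OF finx z(1)] u(1) by blast
  moreover have "w \<le> u" using x'(2) u(1,2) by (force simp: node_less_def)
  moreover have "w \<in> pverts G" using pair_graph_vertsD[OF G u(4)] by simp
  \<comment> \<open>If \<open>a \<le> w\<close> for some \<open>a\<close> in \<open>hd x\<close>,
    then \<open>w \<le> u\<close> and convexity would put \<open>w\<close> into
    \<open>hd x\<close>.\<close>
  ultimately have "w < a" if "a \<in> hd x" for a
    using int that u(3) unfolding interval_of_def by (meson not_le_imp_less)
  then show ?thesis using u by blast
qed

lemma label_R_edge:
  assumes G: "pair_graph G" and x: "x \<in> nodes G" and z: "z \<in> children G x" "label G z = Lab_R"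
  shows "\<exists>u\<in>hd z. \<exists>w. (\<forall>a\<in>hd x. a < w) \<and> (w, u) \<in> parcs G"
proof -
  have fin: "finite (pverts G)" by (rule pair_graph_finite[OF G])
  have int: "interval_of (pverts G) (hd x)" by (rule interval_of_node[OF fin x])
  then have finx: "finite (hd x)" using fin finite_subset unfolding interval_of_def by blast
  have b: "base_label G z = Lab_R" using z(2) label_R_iff by blast
  then obtain x' where x': "x' \<in> grandchildren G (tl x)" "node_less z x'" "quotient_adj G z x'"
    using childrenD(1)[OF finx z(1)] by (auto simp: base_label_def split: if_splits)
  obtain u w where u: "u \<in> hd z" "w \<in> hd x'" "w \<notin> hd x" "(w, u) \<in> parcs G"
    using cousin_edge_beyond[OF G x base_label_not_root[OF finx z(1)] z(1) x'(1,3)] b by auto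
  have "u \<in> hd x" using childrenD(3)[OF finx z(1)] u(1) by blast
  moreover have "u \<le> w" using x'(2) u(1,2) by (force simp: node_less_def)
  moreover have "w \<in> pverts G" using pair_graph_vertsD[OF G u(4)] by simp
  ultimately have "a < w" if "a \<in> hd x" for a
    using int that u(3) unfolding interval_of_def by (meson not_le_imp_less)
  then show ?thesis using u by blast
qed


subsection \<open>Refined quotient graphs as levels\<close>

definition typed_vertices :: "'a::linorder pair_pre_digraph \<Rightarrow> label \<Rightarrow> 'a node \<Rightarrow> 'a set" where
  "typed_vertices G t x = (\<lambda>y. Min (hd y)) ` {y \<in> trimmed_nodes G t x. node_type G y = t}"

lemma node_less_Min:
  assumes "node_less y y'" "finite (hd y)" "hd y \<noteq> {}" "finite (hd y')" "hd y' \<noteq> {}"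
  shows "Min (hd y) < Min (hd y')"
  using assms(1) Min_in[OF assms(2,3)] Min_in[OF assms(4,5)] by (simp add: node_less_def)

text \<open>A vertex of type \<open>t\<close> is its own witness on both sides, so trimming to type
  \<open>t\<close> removes none of them.\<close>

lemma typed_in_trimmed:
  assumes "y \<in> grandchildren G x" "node_type G y = t" "t \<noteq> Lab_O"
  shows "y \<in> trimmed_nodes G t x"
  using assms by (auto simp: trimmed_nodes_def remaining_nodes_def node_type_def)

text \<open>All four class graphs have this form: the right ends of edges have a type in
  \<open>{t, t'}\<close>, where \<open>t\<close> is the trimming type and \<open>t'\<close> its
  companion \<open>Lab_OL\<close> or \<open>Lab_OR\<close>. Both sides are thus treated at
  once.\<close>

lemma collapse_class_graph:
  assumes G: "pair_graph G" and x: "x \<in> nodes G" and H: "pair_graph (class_graph G C {t, t'} t x)"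
    and t: "t \<noteq> Lab_O"
    and t': "\<And>z. label G z = t' \<Longrightarrow> \<exists>z0. immediately_precedes G z0 z \<and> label G z0 = t"
    and beyond: "\<And>z. z \<in> children G x \<Longrightarrow> label G z = t \<Longrightarrow> \<exists>u\<in>hd z. \<exists>w\<in>X. (w, u) \<in> parcs G"
    and X: "X \<inter> hd x = {}"
  shows "collapse G (class_graph G C {t, t'} t x) (hd x) (typed_vertices G t x) X"
proof -
  let ?H = "class_graph G C {t, t'} t x" and ?N = "trimmed_nodes G t x" and ?m = "\<lambda>y. Min (hd y)"
  have fin: "finite (pverts G)" by (rule pair_graph_finite[OF G])
  have sub: "hd x \<subseteq> pverts G" using nodes_props[OF fin x] by simp
  then have finx: "finite (hd x)" using fin finite_subset by blast
  have N: "y \<in> grandchildren G x" if "y \<in> ?N" for y using that trimmed_nodes_subset by blast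
  have HN: "pverts ?H = ?m ` ?N" by (simp add: class_graph_def node_graph_def)
  have less: "?m y < ?m y'"
    if "y \<in> grandchildren G x" "y' \<in> grandchildren G x" "node_less y y'" for y y'
    using node_less_Min[OF that(3)] grandchildrenD[OF finx that(1)] grandchildrenD[OF finx that(2)]
    by blast
  \<comment> \<open>A node whose representative is at most \<open>u\<close> cannot come after
    \<open>y\<close>, so its representative is at most that of \<open>y\<close>.\<close>
  have block: "u \<in> hd x \<inter> block (pverts ?H) (?m y)" if y: "y \<in> ?N" and u: "u \<in> hd y" for y u
  proof -
    note yD = grandchildrenD[OF finx N[OF y]]
    have "?m y' \<le> ?m y" if y': "y' \<in> ?N" "?m y' \<le> u" for y'
    proof -
      note y'D = grandchildrenD[OF finx N[OF y'(1)]]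
      have "\<not> node_less y y'" using y'(2) y'D(7) u by (force simp: node_less_def)
      then have "y' = y \<or> node_less y' y" using grandchildren_total[OF fin x N[OF y] N[OF y'(1)]] by blast
      then show ?thesis using less[OF N[OF y'(1)] N[OF y]] by fastforce
    qed
    then show ?thesis using yD(5,6) u Min_le[OF yD(6) u] by (auto simp: block_def HN)
  qed
  show ?thesis
  proof (rule collapse.intro)
    show "pverts ?H \<subseteq> hd x"
      unfolding class_graph_def by (rule node_graph_verts[OF finx trimmed_nodes_subset])
    show "typed_vertices G t x \<subseteq> pverts ?H" by (auto simp: typed_vertices_def HN)
  next
    fix u v assume "(u, v) \<in> parcs ?H"
    then obtain y y' where y: "y \<in> ?N" "y' \<in> ?N" "u = ?m y" "v = ?m y'" "quotient_adj G y y'"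
      by (auto simp: class_graph_def node_graph_def class_adj_def)
    then obtain a b where "a \<in> hd y" "b \<in> hd y'" "(a, b) \<in> parcs G" by (auto simp: quotient_adj_def)
    then show "\<exists>u' \<in> hd x \<inter> block (pverts ?H) u. \<exists>v' \<in> hd x \<inter> block (pverts ?H) v. (u', v') \<in> parcs G"
      using block[OF y(1)] block[OF y(2)] y(3,4) by blast
  next
    fix s assume "s \<in> typed_vertices G t x"
    then obtain y where y: "y \<in> ?N" "label G (tl y) = t" "s = ?m y"
      by (auto simp: typed_vertices_def node_type_def)
    note yD = grandchildrenD[OF finx N[OF y(1)]]
    obtain u w where uw: "u \<in> hd (tl y)" "w \<in> X" "(w, u) \<in> parcs G"
      using beyond[OF yD(1) y(2)] by blast
    \<comment> \<open>The label only yields a neighbour of some vertex of the parent of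
      \<open>y\<close>; by homogeneity towards the outside, the representative of \<open>y\<close>
      has that neighbour as well.\<close>
    have "(w, ?m y) \<in> parcs G"
      using child_same_outside[OF finx sub G yD(1) uw(1) _ _ uw(3), of "?m y"] yD(4,7) uw(2) X by blast
    then show "\<exists>u\<in>hd x \<inter> block (pverts ?H) s. \<exists>w\<in>X. (w, u) \<in> parcs G"
      using block[OF y(1) yD(7)] uw(2) y(3) by blast
  next
    have *: "\<exists>s\<in>typed_vertices G t x. ?m y \<le> s \<and> s \<le> ?m y'"
      if y: "y \<in> ?N" "y' \<in> ?N" "node_less y y'" "node_type G y' \<in> {t, t'}" "tl y \<noteq> tl y'" for y y'
    proof -
      note yD = grandchildrenD[OF finx N[OF y(1)]] and y'D = grandchildrenD[OF finx N[OF y(2)]]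
      have le: "?m y \<le> ?m y'" using less[OF N[OF y(1)] N[OF y(2)] y(3)] by simp
      have typed: "?m w \<in> typed_vertices G t x" if "w \<in> grandchildren G x" "label G (tl w) = t" for w
        using that typed_in_trimmed[OF that(1) _ t] by (auto simp: typed_vertices_def node_type_def)
      consider "label G (tl y') = t" | "label G (tl y) = t" | "label G (tl y') = t'" "label G (tl y) \<noteq> t"
        using y(4) by (auto simp: node_type_def)
      then show ?thesis
      proof cases
        case 1 then show ?thesis using typed[OF N[OF y(2)]] le by blast
      next
        case 2 then show ?thesis using typed[OF N[OF y(1)]] le by blast
      next
        case 3
        obtain z where z: "immediately_precedes G z (tl y')" "label G z = t" using t'[OF 3(1)] by blast
        have tl: "tl (tl y') = x" using childrenD(1)[OF finx y'D(1)] .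
        then have zx: "z \<in> children G x" and zy': "node_less z (tl y')"
          and imm: "\<And>w. w \<in> children G x \<Longrightarrow> \<not> (node_less z w \<and> node_less w (tl y'))"
          using z(1) by (auto simp: immediately_precedes_def)
        note zD = childrenD[OF finx zx]
        have int: "interval_of (pverts G) (hd v)" if "v \<in> children G x" for v
          using interval_of_child[OF finx interval_of_node[OF fin x] that] .
        have tot: "node_less v w \<or> node_less w v"
          if "v \<in> children G x" "w \<in> children G x" "v \<noteq> w" for v w
          using node_less_total int children_disjoint[OF sub that] childrenD(2)[OF finx] that by metis
        have "\<not> node_less (tl y') (tl y)"
          using y(3) yD(4,7) y'D(4,7) unfolding node_less_def by (meson order.asym subsetD)
        then have yy': "node_less (tl y) (tl y')" using tot[OF yD(1) y'D(1) y(5)] by blast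
        have "tl y \<noteq> z" using z(2) 3(2) by blast
        \<comment> \<open>No child of \<open>x\<close> lies strictly between \<open>z\<close> and
          \<open>tl y'\<close>, and \<open>tl y\<close> differs from \<open>z\<close> by its
          label.\<close>
        then have yz: "node_less (tl y) z" using tot[OF yD(1) zx] imm[OF yD(1)] yy' by blast
        \<comment> \<open>As \<open>x\<close> has a second child, \<open>hd z\<close> differs from
          \<open>hd x\<close>, so \<open>z\<close> is not a leaf. Its child \<open>w\<close> is a
          vertex of type \<open>t\<close> between \<open>y\<close> and \<open>y'\<close>.\<close>
        have "z \<noteq> tl y'" using zy' zD(2) by (auto simp: node_less_def)
        then have "hd z \<noteq> hd x"
          using children_disjoint[OF sub zx y'D(1)] childrenD(2,3)[OF finx y'D(1)] by blast
        then have "\<not> is_leaf z" using zD(1) by (simp add: is_leaf_def)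
        then obtain w where w: "w \<in> children G z" using children_nonempty[OF zD(4,2)] by blast
        have wx: "w \<in> grandchildren G x" using w zx by (auto simp: grandchildren_def)
        have tlw: "tl w = z" using childrenD(1)[OF zD(4) w] .
        note wD = grandchildrenD[OF finx wx]
        have "?m y \<in> hd (tl y)" "?m w \<in> hd z" "?m y' \<in> hd (tl y')"
          using yD(4,7) wD(4,7) y'D(4,7) tlw by auto
        then have "?m y < ?m w" "?m w < ?m y'" using yz zy' by (auto simp: node_less_def)
        then show ?thesis using typed[OF wx] z(2) tlw by (intro bexI[of _ "?m w"]) auto
      qed
    qed
    fix u v assume "(u, v) \<in> parcs ?H"
    then obtain y y' where y: "y \<in> ?N" "y' \<in> ?N" "u = ?m y" "v = ?m y'" "class_adj G C {t, t'} y y'"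
      by (auto simp: class_graph_def node_graph_def)
    have ne: "tl y \<noteq> tl y'" using y(5) by (simp add: class_adj_def quotient_adj_def)
    \<comment> \<open>The later end of the edge is the one with type in \<open>{t, t'}\<close>; it
      becomes the second node in \<open>*\<close>.\<close>
    consider "node_less y y'" "node_type G y' \<in> {t, t'}" | "node_less y' y" "node_type G y \<in> {t, t'}"
      using y(5) unfolding class_adj_def by blast
    then show "\<exists>s\<in>typed_vertices G t x. min u v \<le> s \<and> s \<le> max u v"
    proof cases
      case 1
      then show ?thesis using *[OF y(1,2) 1 ne] y(3,4) by (auto simp: min_le_iff_disj le_max_iff_disj)
    next
      case 2
      then show ?thesis using *[OF y(2,1) 2] ne y(3,4) by (auto simp: min_le_iff_disj le_max_iff_disj)
    qed
  qed (fact G H)+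
qed

text \<open>By trimming, some \<open>a\<close> of type \<open>t\<close> lies at or before the first
  vertex. It survives the trimming itself, so it is the first vertex. The last vertex is treated
  symmetrically.\<close>

lemma class_graph_extreme_typed:
  assumes G: "pair_graph G" and x: "x \<in> nodes G" and t: "t \<noteq> Lab_O"
    and H: "H = class_graph G C D t x" "pverts H \<noteq> {}"
  shows "Min (pverts H) \<in> typed_vertices G t x" "Max (pverts H) \<in> typed_vertices G t x"
proof -
  let ?N = "trimmed_nodes G t x" and ?m = "\<lambda>y. Min (hd y)"
  have fin: "finite (pverts G)" by (rule pair_graph_finite[OF G])
  have sub: "hd x \<subseteq> pverts G" using nodes_props[OF fin x] by simp
  then have finx: "finite (hd x)" using fin finite_subset by blast
  have HN: "pverts H = ?m ` ?N" by (simp add: H(1) class_graph_def node_graph_def)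
  have finH: "finite (pverts H)"
    unfolding H(1) class_graph_def
    by (rule finite_subset[OF node_graph_verts[OF finx trimmed_nodes_subset] finx])
  have less: "?m y < ?m y'"
    if "y \<in> grandchildren G x" "y' \<in> grandchildren G x" "node_less y y'" for y y'
    using node_less_Min[OF that(3)] grandchildrenD[OF finx that(1)] grandchildrenD[OF finx that(2)]
    by blast
  have typed: "?m a \<in> typed_vertices G t x" "?m a \<in> pverts H"
    if "a \<in> remaining_nodes G x" "node_type G a = t" for a
    using that typed_in_trimmed[of a G x t] t by (auto simp: typed_vertices_def HN remaining_nodes_def)
  have gc: "y \<in> grandchildren G x" if "y \<in> remaining_nodes G x" for y
    using that by (simp add: remaining_nodes_def)
  obtain y where y: "y \<in> ?N" "Min (pverts H) = ?m y" using Min_in[OF finH H(2)] HN by auto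
  then obtain a where a: "a \<in> remaining_nodes G x" "node_type G a = t" "a = y \<or> node_less a y"
    and yr: "y \<in> remaining_nodes G x"
    unfolding trimmed_nodes_def by blast
  have "?m y \<le> ?m a" using Min_le[OF finH typed(2)[OF a(1,2)]] y(2) by simp
  then have "a = y" using a(3) less[OF gc[OF a(1)] gc[OF yr]] by fastforce
  then show "Min (pverts H) \<in> typed_vertices G t x" using typed(1)[OF a(1,2)] y(2) by simp
  obtain y where y: "y \<in> ?N" "Max (pverts H) = ?m y" using Max_in[OF finH H(2)] HN by auto
  then obtain a where a: "a \<in> remaining_nodes G x" "node_type G a = t" "a = y \<or> node_less y a"
    and yr: "y \<in> remaining_nodes G x"
    unfolding trimmed_nodes_def by blast
  have "?m a \<le> ?m y" using Max_ge[OF finH typed(2)[OF a(1,2)]] y(2) by simp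
  then have "a = y" using a(3) less[OF gc[OF yr] gc[OF a(1)]] by fastforce
  then show "Max (pverts H) \<in> typed_vertices G t x" using typed(1)[OF a(1,2)] y(2) by simp
qed

lemma monotone_bipartite_if_no_arcs: "parcs H = {} \<Longrightarrow> monotone_bipartite H"
  unfolding monotone_bipartite_def by (intro exI[of _ "pverts H"] exI[of _ "{}"]) auto

lemma refined_quotient_level:
  assumes G: "pair_graph G" and H: "H \<in> refined_quotients G" "\<not> monotone_bipartite H"
  shows "left_level G H \<or> right_level G H"
proof -
  obtain x where x: "x \<in> nodes G" "H \<in> refined_quotients_at G x"
    using H(1) by (auto simp: refined_quotients_def)
  have HP: "pair_graph H" by (rule refined_quotients_props(1)[OF G H(1)])
  have ne: "pverts H \<noteq> {}"
    using monotone_bipartite_if_no_arcs[of H] H(2) pair_graph_vertsD[OF HP] by fast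
  \<comment> \<open>Since \<open>H\<close> is not monotone bipartite, it is one of the four class
    graphs; the class of the right ends determines the side.\<close>
  obtain C where "H = class_graph G C {Lab_L, Lab_OL} Lab_L x \<or> H = class_graph G C {Lab_R, Lab_OR} Lab_R x"
    using x(2) H(2) by (auto simp: refined_quotients_at_def split: if_splits)
  then show ?thesis
  proof
    assume eq: "H = class_graph G C {Lab_L, Lab_OL} Lab_L x"
    have "collapse G H (hd x) (typed_vertices G Lab_L x) {w. \<forall>a\<in>hd x. w < a}"
      unfolding eq
    proof (rule collapse_class_graph[OF G x(1) HP[unfolded eq]])
      show "\<exists>u\<in>hd z. \<exists>w\<in>{w. \<forall>a\<in>hd x. w < a}. (w, u) \<in> parcs G"
        if "z \<in> children G x" "label G z = Lab_L" for z
        using label_L_edge[OF G x(1) that] by blast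
    qed (use label_OL_preceding in auto)
    then show ?thesis
      using class_graph_extreme_typed(1)[OF G x(1) _ eq ne] unfolding left_level_def by blast
  next
    assume eq: "H = class_graph G C {Lab_R, Lab_OR} Lab_R x"
    have "collapse G H (hd x) (typed_vertices G Lab_R x) {w. \<forall>a\<in>hd x. a < w}"
      unfolding eq
    proof (rule collapse_class_graph[OF G x(1) HP[unfolded eq]])
      show "\<exists>u\<in>hd z. \<exists>w\<in>{w. \<forall>a\<in>hd x. a < w}. (w, u) \<in> parcs G"
        if "z \<in> children G x" "label G z = Lab_R" for z
        using label_R_edge[OF G x(1) that] by blast
    qed (use label_OR_preceding in auto)
    then show ?thesis
      using class_graph_extreme_typed(2)[OF G x(1) _ eq ne] unfolding right_level_def by blast
  qed
qed

section \<open>Induction on the number of classes, three levels at a time\<close>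

lemma delayed_rank_positive:
  "0 < delayed_rank G \<Longrightarrow> pair_graph G \<and> \<not> monotone_bipartite G"
  by (rule ccontr) (simp add: delayed_rank.simps[of G])

text \<open>Some \<open>H\<close> attains the maximum. Because \<open>n\<close> is positive,
  \<open>H\<close> has positive rank, so it is not monotone bipartite and forms a level below
  \<open>G\<close>.\<close>

lemma delayed_rank_Suc:
  assumes "Suc n \<le> delayed_rank G" "0 < n"
  shows "\<exists>H. n \<le> delayed_rank H \<and> (left_level G H \<or> right_level G H)"
proof -
  have G: "pair_graph G" "\<not> monotone_bipartite G" using delayed_rank_positive[of G] assms by auto
  note fn = refined_quotients_finite_nonempty[OF G(1)]
  have "delayed_rank G = 1 + Max (delayed_rank ` refined_quotients G)"
    using G by (simp add: delayed_rank.simps[of G])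
  moreover obtain H where H: "H \<in> refined_quotients G"
    "delayed_rank H = Max (delayed_rank ` refined_quotients G)"
    using Max_in[of "delayed_rank ` refined_quotients G"] fn by fastforce
  ultimately have n: "n \<le> delayed_rank H" using assms(1) by simp
  then have "\<not> monotone_bipartite H" using delayed_rank_positive[of H] assms(2) by auto
  then show ?thesis using refined_quotient_level[OF G(1) H(1)] n by blast
qed

text \<open>Positive rank gives an edge, which settles a single class; each further class costs
  three levels. Demanding an edge inside every class is the strengthening that carries the
  induction.\<close>

lemma delayed_rank_clique_colouring:
  "3 * r + 1 \<le> delayed_rank G \<Longrightarrow> \<exists>f. clique_colouring G (Suc r) {..<Suc r} f"
proof (induction r arbitrary: G)
  case 0
  then have G: "\<not> monotone_bipartite G" using delayed_rank_positive[of G] by simp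
  then obtain u v where "(u, v) \<in> parcs G" using monotone_bipartite_if_no_arcs[of G] by fast
  then have "clique_colouring G (Suc 0) {..<Suc 0} (\<lambda>_. 0)"
    by (intro clique_colouringI) auto
  then show ?case by blast
next
  case (Suc r)
  obtain G1 where G1: "3 * r + 3 \<le> delayed_rank G1" "left_level G G1 \<or> right_level G G1"
    using delayed_rank_Suc[of "3 * r + 3" G] Suc.prems by auto
  obtain G2 where G2: "3 * r + 2 \<le> delayed_rank G2" "left_level G1 G2 \<or> right_level G1 G2"
    using delayed_rank_Suc[of "3 * r + 2" G1] G1(1) by auto
  obtain G3 where G3: "3 * r + 1 \<le> delayed_rank G3" "left_level G2 G3 \<or> right_level G2 G3"
    using delayed_rank_Suc[of "3 * r + 1" G2] G2(1) by auto
  obtain f where "clique_colouring G3 (Suc r) {..<Suc r} f" using Suc.IH[OF G3(1)] by blast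
  then show ?case using three_levels[OF G1(2) G2(2) G3(2)] by blast
qed

theorem theorem21:
  fixes G :: "'a::linorder pair_pre_digraph" and r :: nat
  assumes "r \<ge> 1"
    and "pair_graph G"
    and "delayed_rank G \<ge> 3 * r - 2"
  shows "has_complete_interval_minor G r"
proof -
  obtain s where s: "r = Suc s" using assms(1) by (cases r) auto
  then have "3 * s + 1 \<le> delayed_rank G" using assms(3) by simp
  then show ?thesis
    using delayed_rank_clique_colouring complete_interval_minor_if_clique_colouring[OF assms(2)] s
    by blast
qed

end
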